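(* Let $\alpha\in\mathbb{C}$ and $\beta\in\mathbb{C}\setminus\{0\}$, and let $P=M_{\alpha,\beta}=(\xi-\alpha,\,K-\beta)$ be the corresponding maximal ideal of $R$. Suppose that $$\alpha\neq-\frac{1}{q-q^{-1}}\left(\frac{q^{-2m}(1-q^{-2nm})}{1-q^{-2m}}\beta^{m}-\frac{q^{2m}(1-q^{2nm})}{1-q^{2m}}\beta^{-m}\right)\quad\text{for every integer } n\geq 0$$ and $$\alpha\neq\frac{1}{q-q^{-1}}\left(\frac{1-q^{2nm}}{1-q^{2m}}\beta^{m}-\frac{1-q^{-2nm}}{1-q^{-2m}}\beta^{-m}\right)\quad\text{for every integer } n\geq 1.$$ Then $U/P_{\infty,\infty}$, where $P_{\infty,\infty}=UP$, is an infinite dimensional irreducible weight representation of $U$.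
   Context: Let $q\in\mathbb{C}$ be nonzero and not a root of unity, and let $m\geq 1$ be an integer. Put $f_m(K)=\frac{K^{m}-K^{-m}}{q-q^{-1}}$. $U=U_q(f_m(K))$ is the associative unital $\mathbb{C}$-algebra generated by $E,F,K^{\pm1}$ with relations $KE=q^{2}EK$, $KF=q^{-2}FK$, $KK^{-1}=K^{-1}K=1$, $EF-FE=f_m(K)$. Let $\xi=EF$ and let $R$ be the (commutative) subalgebra of $U$ generated by $\xi,K^{\pm1}$. A weight representation of $U$ is a left $U$-module which is the direct sum of the eigenspaces of $K$. *)

theory Defs
  imports Complex_Main "HOL-Library.Poly_Mapping" "HOL-Algebra.Algebra"
begin

section \<open>The free algebra on E, F, K and the inverse of K\<close>

datatype gen = gen_E | gen_F | gen_K | gen_Kinv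

text \<open>
  Words in the generators form a monoid under concatenation. The monoid is written additively
  because that is the class over which the type of finitely supported functions forms its
  convolution algebra; \<open>word \<Rightarrow>\<^sub>0 complex\<close> is then the free associative unital algebra.
\<close>

datatype word = Word "gen list"

instantiation word :: monoid_add
begin

definition zero_word :: word
  where "0 = Word []"

fun plus_word :: "word \<Rightarrow> word \<Rightarrow> word"
  where "Word u + Word v = Word (u @ v)"

instance
proof
  fix a b c :: word
  show "a + b + c = a + (b + c)"
    by (cases a; cases b; cases c) simp
  show "0 + a = a" "a + 0 = a"
    by (cases a; simp add: zero_word_def)+
qed

end

type_synonym free_alg = "word \<Rightarrow>\<^sub>0 complex"

definition free_gen :: "gen \<Rightarrow> free_alg"
  where "free_gen g = Poly_Mapping.single (Word [g]) 1"

definition free_scalar :: "complex \<Rightarrow> free_alg"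
  where "free_scalar c = Poly_Mapping.single 0 c"

definition free_ring :: "free_alg ring"
  where "free_ring = \<lparr>carrier = UNIV, monoid.mult = (*), one = 1, ring.zero = 0, add = (+)\<rparr>"


section \<open>The algebra U\<close>

definition f_K :: "complex \<Rightarrow> nat \<Rightarrow> free_alg"
  where "f_K q m =
    free_scalar (1 / (q - inverse q)) * (free_gen gen_K ^ m - free_gen gen_Kinv ^ m)"

definition U_relators :: "complex \<Rightarrow> nat \<Rightarrow> free_alg set"
  where "U_relators q m =
    (let E = free_gen gen_E; F = free_gen gen_F; K = free_gen gen_K; K' = free_gen gen_Kinv in
      {K * E - free_scalar (q powi 2) * E * K,
       K * F - free_scalar (q powi (-2)) * F * K,
       K * K' - 1,
       K' * K - 1,
       E * F - F * E - f_K q m})"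

definition U_ideal :: "complex \<Rightarrow> nat \<Rightarrow> free_alg set"
  where "U_ideal q m = Idl\<^bsub>free_ring\<^esub> (U_relators q m)"

type_synonym U_elem = "free_alg set"

definition U_alg :: "complex \<Rightarrow> nat \<Rightarrow> U_elem ring"
  where "U_alg q m = free_ring Quot U_ideal q m"

definition U_gen :: "complex \<Rightarrow> nat \<Rightarrow> gen \<Rightarrow> U_elem"
  where "U_gen q m g = U_ideal q m +>\<^bsub>free_ring\<^esub> free_gen g"

text \<open>The structure map of U as a complex algebra, sending c to c times the identity.\<close>

definition U_scalar :: "complex \<Rightarrow> nat \<Rightarrow> complex \<Rightarrow> U_elem"
  where "U_scalar q m c = U_ideal q m +>\<^bsub>free_ring\<^esub> free_scalar c"

definition U_xi :: "complex \<Rightarrow> nat \<Rightarrow> U_elem"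
  where "U_xi q m = U_gen q m gen_E \<otimes>\<^bsub>U_alg q m\<^esub> U_gen q m gen_F"

text \<open>The subalgebra R; the scalars are adjoined because \<^const>\<open>generate_ring\<close> only yields subrings.\<close>

definition R_alg :: "complex \<Rightarrow> nat \<Rightarrow> U_elem ring"
  where "R_alg q m = (U_alg q m)\<lparr>carrier := generate_ring (U_alg q m)
    (range (U_scalar q m) \<union> {U_xi q m, U_gen q m gen_K, U_gen q m gen_Kinv})\<rparr>"

definition M_ideal :: "complex \<Rightarrow> nat \<Rightarrow> complex \<Rightarrow> complex \<Rightarrow> U_elem set"
  where "M_ideal q m \<alpha> \<beta> = Idl\<^bsub>R_alg q m\<^esub>
    {U_xi q m \<ominus>\<^bsub>U_alg q m\<^esub> U_scalar q m \<alpha>,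
     U_gen q m gen_K \<ominus>\<^bsub>U_alg q m\<^esub> U_scalar q m \<beta>}"


section \<open>Left modules\<close>

text \<open>The axioms of the library locale \<^locale>\<open>module\<close>, without commutativity of the ring.\<close>

locale left_module = R?: ring R + M?: abelian_group M
  for R :: "('a, 'c) ring_scheme" (structure) and M :: "('a, 'b, 'd) module_scheme" (structure) +
  assumes smult_closed:
      "\<lbrakk>a \<in> carrier R; x \<in> carrier M\<rbrakk> \<Longrightarrow> a \<odot>\<^bsub>M\<^esub> x \<in> carrier M"
    and smult_l_distr:
      "\<lbrakk>a \<in> carrier R; b \<in> carrier R; x \<in> carrier M\<rbrakk> \<Longrightarrow>
        (a \<oplus> b) \<odot>\<^bsub>M\<^esub> x = a \<odot>\<^bsub>M\<^esub> x \<oplus>\<^bsub>M\<^esub> b \<odot>\<^bsub>M\<^esub> x"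
    and smult_r_distr:
      "\<lbrakk>a \<in> carrier R; x \<in> carrier M; y \<in> carrier M\<rbrakk> \<Longrightarrow>
        a \<odot>\<^bsub>M\<^esub> (x \<oplus>\<^bsub>M\<^esub> y) = a \<odot>\<^bsub>M\<^esub> x \<oplus>\<^bsub>M\<^esub> a \<odot>\<^bsub>M\<^esub> y"
    and smult_assoc:
      "\<lbrakk>a \<in> carrier R; b \<in> carrier R; x \<in> carrier M\<rbrakk> \<Longrightarrow>
        (a \<otimes> b) \<odot>\<^bsub>M\<^esub> x = a \<odot>\<^bsub>M\<^esub> (b \<odot>\<^bsub>M\<^esub> x)"
    and smult_one:
      "x \<in> carrier M \<Longrightarrow> \<one> \<odot>\<^bsub>M\<^esub> x = x"

definition irreducible_module :: "('a, 'c) ring_scheme \<Rightarrow> ('a, 'b, 'd) module_scheme \<Rightarrow> bool"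
  where "irreducible_module R M \<longleftrightarrow>
    left_module R M \<and> carrier M \<noteq> {\<zero>\<^bsub>M\<^esub>} \<and>
    (\<forall>N. submodule N R M \<longrightarrow> N = {\<zero>\<^bsub>M\<^esub>} \<or> N = carrier M)"

text \<open>
  The left module R/I for a left ideal I. The fields \<^const>\<open>monoid.mult\<close> and \<^const>\<open>monoid.one\<close>, inherited by
  module records from ring records, play no role for modules.
\<close>

definition quotient_module :: "('a, 'c) ring_scheme \<Rightarrow> 'a set \<Rightarrow> ('a, 'a set) module"
  where "quotient_module R I =
    \<lparr>carrier = a_rcosets\<^bsub>R\<^esub> I, monoid.mult = undefined, one = undefined,
     ring.zero = I, add = set_add R,
     smult = (\<lambda>a A. \<Union>x\<in>A. I +>\<^bsub>R\<^esub> (a \<otimes>\<^bsub>R\<^esub> x))\<rparr>"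


section \<open>Representations of U\<close>

definition weight_space ::
    "complex \<Rightarrow> nat \<Rightarrow> (U_elem, 'b, 'd) module_scheme \<Rightarrow> complex \<Rightarrow> 'b set"
  where "weight_space q m M c =
    {v \<in> carrier M. U_gen q m gen_K \<odot>\<^bsub>M\<^esub> v = U_scalar q m c \<odot>\<^bsub>M\<^esub> v}"

text \<open>
  The family \<open>w\<close> lists the components of \<open>v\<close>; its existence says that the eigenspaces of K span,
  its uniqueness that their sum is direct.
\<close>

definition weight_representation ::
    "complex \<Rightarrow> nat \<Rightarrow> (U_elem, 'b, 'd) module_scheme \<Rightarrow> bool"
  where "weight_representation q m M \<longleftrightarrow>
    left_module (U_alg q m) M \<and>
    (\<forall>v \<in> carrier M. \<exists>!w.
      (\<forall>c. w c \<in> weight_space q m M c) \<and>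
      finite {c. w c \<noteq> \<zero>\<^bsub>M\<^esub>} \<and>
      v = (\<Oplus>\<^bsub>M\<^esub>c\<in>{c. w c \<noteq> \<zero>\<^bsub>M\<^esub>}. w c))"

definition finite_dimensional ::
    "complex \<Rightarrow> nat \<Rightarrow> (U_elem, 'b, 'd) module_scheme \<Rightarrow> bool"
  where "finite_dimensional q m M \<longleftrightarrow>
    (\<exists>S. finite S \<and> S \<subseteq> carrier M \<and>
      (\<forall>v \<in> carrier M. \<exists>a. v = (\<Oplus>\<^bsub>M\<^esub>s\<in>S. U_scalar q m (a s) \<odot>\<^bsub>M\<^esub> s)))"

text \<open>
  U/UP. Here \<^const>\<open>ideal_prod\<close> is applied to all of U and a subset P; its members are the finite
  sums of products \<open>u p\<close>.
\<close>

definition U_mod :: "complex \<Rightarrow> nat \<Rightarrow> U_elem set \<Rightarrow> (U_elem, U_elem set) module"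
  where "U_mod q m P =
    quotient_module (U_alg q m) (ideal_prod (U_alg q m) (carrier (U_alg q m)) P)"

end

theory Submission
  imports Defs
begin

text \<open>
  Let \<open>V\<close> be the space with basis \<open>v\<^sub>n\<close>, \<open>n\<close> an integer, and let \<open>U\<close> act by
  \<open>E v\<^sub>n = v\<^sub>n\<^sub>+\<^sub>1\<close>, \<open>F v\<^sub>n = \<epsilon>(n) v\<^sub>n\<^sub>-\<^sub>1\<close> and \<open>K v\<^sub>n = \<kappa>(n) v\<^sub>n\<close>, where \<open>\<kappa>(n) = q\<^sup>2\<^sup>n \<beta>\<close>.
  Then \<open>\<xi> = EF\<close> acts on \<open>v\<^sub>n\<close> as \<open>\<epsilon>(n)\<close> and \<open>FE\<close> as \<open>\<epsilon>(n + 1)\<close>, so the relation \<open>EF - FE = f\<^sub>m(K)\<close>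
  says precisely that \<open>\<epsilon>(n) - \<epsilon>(n + 1)\<close> is the value of \<open>f\<^sub>m\<close> at \<open>\<kappa>(n)\<close>. Starting from \<open>\<epsilon>(0) = \<alpha>\<close>, this
  recursion is a pair of geometric sums in both directions, and the two excluded families of values
  of \<open>\<alpha>\<close> are those for which \<open>\<epsilon>\<close> vanishes at some \<open>n \<le> 0\<close> or at some \<open>n \<ge> 1\<close>.

  So all \<open>\<epsilon>(n)\<close> are nonzero, and \<open>E\<close> and \<open>F\<close> lead from each \<open>v\<^sub>n\<close> to all the others. The weights
  \<open>\<kappa>(n)\<close> are pairwise distinct, as \<open>q\<close> is not a root of unity, so a nonzero invariant subspace
  contains some \<open>v\<^sub>n\<close> and therefore everything (\<open>invariant_subspace_trivial\<close>). Thus \<open>V\<close> is an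
  irreducible weight representation of infinite dimension.

  It remains to see that \<open>u \<mapsto> u v\<^sub>0\<close> induces an isomorphism of \<open>U/UP\<close> with \<open>V\<close>, that is, that \<open>UP\<close> is
  the annihilator of \<open>v\<^sub>0\<close> (\<open>UP_eq\<close>). The ring \<open>R\<close> acts on \<open>v\<^sub>0\<close> by scalars, so the elements of \<open>R\<close>
  that annihilate \<open>v\<^sub>0\<close> form an ideal containing the two generators of \<open>P\<close>; hence \<open>UP\<close> annihilates
  \<open>v\<^sub>0\<close>. Conversely, suitable multiples of the powers of \<open>E\<close> and \<open>F\<close> multiply modulo \<open>UP\<close> just as the
  \<open>v\<^sub>n\<close> do, so every element of \<open>U\<close> is, modulo \<open>UP\<close>, a combination of these multiples whose
  coefficients are read off from \<open>u v\<^sub>0\<close> (\<open>cong_vec_lift\<close>).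

  The action is defined on the free algebra, and elements of \<open>U\<close> are handled through
  representatives there.
\<close>


section \<open>The free algebra\<close>

lemma free_ring_simps [simp]:
  "carrier free_ring = UNIV" "x \<otimes>\<^bsub>free_ring\<^esub> y = x * y" "x \<oplus>\<^bsub>free_ring\<^esub> y = x + y"
  "\<one>\<^bsub>free_ring\<^esub> = 1" "\<zero>\<^bsub>free_ring\<^esub> = 0"
  by (simp_all add: free_ring_def)

lemma ring_free_ring: "ring free_ring"
proof (rule ringI)
  show "abelian_group free_ring"
  proof (rule abelian_groupI)
    show "\<exists>y\<in>carrier free_ring. y \<oplus>\<^bsub>free_ring\<^esub> x = \<zero>\<^bsub>free_ring\<^esub>" for x
      by (rule bexI[of _ "-x"]) simp_all
  qed (simp_all add: algebra_simps)
  show "Group.monoid free_ring"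
    by (rule monoidI) (simp_all add: algebra_simps)
qed (simp_all add: algebra_simps)

interpretation free: ring free_ring
  by (rule ring_free_ring)

lemma free_ring_uminus [simp]: "\<ominus>\<^bsub>free_ring\<^esub> x = - x"
  by (rule free.minus_equality) simp_all

lemma free_scalar_simps:
  "free_scalar c * free_scalar d = free_scalar (c * d)"
  "free_scalar c + free_scalar d = free_scalar (c + d)"
  "free_scalar c - free_scalar d = free_scalar (c - d)"
  "free_scalar 0 = 0" "free_scalar 1 = 1"
  by (simp_all add: free_scalar_def mult_single single_add single_diff)

lemma poly_mapping_single_induct [case_names single add]:
  fixes a :: "'a \<Rightarrow>\<^sub>0 'b::monoid_add"
  assumes single: "\<And>k c. P (Poly_Mapping.single k c)"
    and add: "\<And>a b. P a \<Longrightarrow> P b \<Longrightarrow> P (a + b)"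
  shows "P a"
proof (induction a rule: update_induct)
  case const
  then show ?case using single[of undefined 0] by simp
next
  case (update f a b)
  have "Poly_Mapping.update a b f = f + Poly_Mapping.single a b"
  proof (rule poly_mapping_eqI)
    fix k
    show "poly_mapping.lookup (Poly_Mapping.update a b f) k = poly_mapping.lookup (f + Poly_Mapping.single a b) k"
      using update(1) by (auto simp: lookup_update lookup_add lookup_single in_keys_iff)
  qed
  then show ?case using update add single by simp
qed

lemma free_scalar_central: "a * free_scalar c = free_scalar c * a"
  by (induction a rule: poly_mapping_single_induct)
    (simp_all add: free_scalar_def mult_single algebra_simps)

lemma free_scalar_left_commute: "a * (free_scalar c * b) = free_scalar c * (a * b)"
  by (metis free_scalar_central mult.assoc)

text \<open>
  A property that survives sums and left multiplication by generators only needs to be checked on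
  scalars, since every word is built from the empty word by prefixing letters.
\<close>

lemma free_alg_induct [case_names scalar add gen]:
  assumes scalar: "\<And>c. P (free_scalar c)"
    and add: "\<And>a b. P a \<Longrightarrow> P b \<Longrightarrow> P (a + b)"
    and gen: "\<And>g a. P a \<Longrightarrow> P (free_gen g * a)"
  shows "P a"
proof (induction a rule: poly_mapping_single_induct)
  case (single k c)
  have "P (Poly_Mapping.single (Word gs) c)" for gs
  proof (induction gs)
    case Nil
    then show ?case using scalar[of c] by (simp add: free_scalar_def zero_word_def)
  next
    case (Cons g gs)
    then show ?case using gen[of "Poly_Mapping.single (Word gs) c" g]
      by (simp add: free_gen_def mult_single)
  qed
  then show ?case by (cases k) simp
qed (use add in auto)


section \<open>Cosets of the defining ideal\<close>

lemma ideal_U_ideal: "ideal (U_ideal q m) free_ring"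
  unfolding U_ideal_def by (rule free.genideal_ideal) simp

lemma U_relators_subset: "U_relators q m \<subseteq> U_ideal q m"
  unfolding U_ideal_def by (rule free.genideal_self) simp

lemma ring_U_alg: "ring (U_alg q m)"
  unfolding U_alg_def by (rule ideal.quotient_is_ring[OF ideal_U_ideal])

definition U_class :: "complex \<Rightarrow> nat \<Rightarrow> free_alg \<Rightarrow> U_elem"
  where "U_class q m a = U_ideal q m +>\<^bsub>free_ring\<^esub> a"

lemma U_class_hom: "ring_hom_ring free_ring (U_alg q m) (U_class q m)"
  unfolding U_alg_def using ideal.rcos_ring_hom_ring[OF ideal_U_ideal]
  by (simp add: U_class_def[abs_def])

lemma carrier_U_alg: "carrier (U_alg q m) = range (U_class q m)"
  by (auto simp: U_alg_def FactRing_def A_RCOSETS_def RCOSETS_def U_class_def a_r_coset_def)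

lemma U_class_closed [simp]: "U_class q m a \<in> carrier (U_alg q m)"
  by (simp add: carrier_U_alg)

lemma U_class_simps:
  "U_class q m a \<oplus>\<^bsub>U_alg q m\<^esub> U_class q m b = U_class q m (a + b)"
  "U_class q m a \<otimes>\<^bsub>U_alg q m\<^esub> U_class q m b = U_class q m (a * b)"
  "\<one>\<^bsub>U_alg q m\<^esub> = U_class q m 1"
  "\<zero>\<^bsub>U_alg q m\<^esub> = U_class q m 0"
  "\<ominus>\<^bsub>U_alg q m\<^esub> U_class q m a = U_class q m (- a)"
  "U_class q m a \<ominus>\<^bsub>U_alg q m\<^esub> U_class q m b = U_class q m (a - b)"
proof -
  interpret h: ring_hom_ring free_ring "U_alg q m" "U_class q m"
    by (rule U_class_hom)
  show "U_class q m a \<oplus>\<^bsub>U_alg q m\<^esub> U_class q m b = U_class q m (a + b)"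
    and mult: "U_class q m a \<otimes>\<^bsub>U_alg q m\<^esub> U_class q m b = U_class q m (a * b)" for a b
    using h.hom_add[of a b] h.hom_mult[of a b] by simp_all
  show "\<one>\<^bsub>U_alg q m\<^esub> = U_class q m 1" "\<zero>\<^bsub>U_alg q m\<^esub> = U_class q m 0"
    using h.hom_one h.hom_zero by simp_all
  show "\<ominus>\<^bsub>U_alg q m\<^esub> U_class q m a = U_class q m (- a)"
    using h.hom_a_inv[of a] by simp
  then show "U_class q m a \<ominus>\<^bsub>U_alg q m\<^esub> U_class q m b = U_class q m (a - b)"
    using h.hom_add[of a "-b"] h.hom_a_inv[of b] by (simp add: a_minus_def)
qed

lemma U_class_eq_iff: "U_class q m a = U_class q m b \<longleftrightarrow> a - b \<in> U_ideal q m"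
  using free.quotient_eq_iff_same_a_r_cos[OF ideal_U_ideal, of a b]
  by (simp add: U_class_def a_minus_def)

lemma U_gen_class: "U_gen q m g = U_class q m (free_gen g)"
  and U_scalar_class: "U_scalar q m c = U_class q m (free_scalar c)"
  and U_xi_class: "U_xi q m = U_class q m (free_gen gen_E * free_gen gen_F)"
  by (simp_all add: U_gen_def U_scalar_def U_xi_def U_class_simps flip: U_class_def)

lemma ring_R_alg: "ring (R_alg q m)"
  unfolding R_alg_def
  by (rule ring.generate_ring_is_ring[OF ring_U_alg])
    (auto simp: U_gen_class U_scalar_class U_xi_class)

lemma M_generators_R_alg:
  "U_xi q m \<ominus>\<^bsub>U_alg q m\<^esub> U_scalar q m c \<in> carrier (R_alg q m)"
  "U_gen q m gen_K \<ominus>\<^bsub>U_alg q m\<^esub> U_scalar q m c \<in> carrier (R_alg q m)"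
  unfolding R_alg_def a_minus_def
  by (simp, intro generate_ring.eng_add generate_ring.a_inv; rule generate_ring.incl; simp)+

lemma M_generators_M_ideal:
  "U_xi q m \<ominus>\<^bsub>U_alg q m\<^esub> U_scalar q m \<alpha> \<in> M_ideal q m \<alpha> \<beta>"
  "U_gen q m gen_K \<ominus>\<^bsub>U_alg q m\<^esub> U_scalar q m \<beta> \<in> M_ideal q m \<alpha> \<beta>"
  unfolding M_ideal_def by (auto simp: genideal_def)


section \<open>The action of U on a string of weight vectors\<close>

type_synonym weight_vec = "int \<Rightarrow>\<^sub>0 complex"

lift_definition diag :: "(int \<Rightarrow> complex) \<Rightarrow> weight_vec \<Rightarrow> weight_vec"
  is "\<lambda>d v n. d n * v n"
  by (rule finite_subset) auto

lift_definition shift :: "int \<Rightarrow> weight_vec \<Rightarrow> weight_vec"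
  is "\<lambda>k v n. v (n - k)"
proof -
  fix k :: int and v :: "int \<Rightarrow> complex"
  assume "finite {n. v n \<noteq> 0}"
  then have "finite ((\<lambda>n. n + k) ` {n. v n \<noteq> 0})"
    by simp
  moreover have "{n. v (n - k) \<noteq> 0} \<subseteq> (\<lambda>n. n + k) ` {n. v n \<noteq> 0}"
    by (auto intro!: image_eqI[where x = "_ - k"])
  ultimately show "finite {n. v (n - k) \<noteq> 0}"
    using finite_subset by blast
qed

abbreviation scale :: "complex \<Rightarrow> weight_vec \<Rightarrow> weight_vec"
  where "scale c \<equiv> diag (\<lambda>_. c)"

lemma lookup_diag [simp]: "poly_mapping.lookup (diag d v) n = d n * poly_mapping.lookup v n"
  by transfer simp

lemma lookup_shift [simp]: "poly_mapping.lookup (shift k v) n = poly_mapping.lookup v (n - k)"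
  by transfer simp

lemmas weight_vec_simps = poly_mapping_eq_iff fun_eq_iff lookup_add lookup_minus

lemma diag_single [simp]: "diag d (Poly_Mapping.single n c) = Poly_Mapping.single n (d n * c)"
  by (auto simp: weight_vec_simps lookup_single when_def)

lemma diag_one [simp]: "diag d 1 = Poly_Mapping.single 0 (d 0)"
  using diag_single[of d 0 1] by simp

lemma shift_single [simp]: "shift k (Poly_Mapping.single n c) = Poly_Mapping.single (n + k) c"
  by (auto simp: weight_vec_simps lookup_single when_def)

lemma diag_add: "diag d (u + v) = diag d u + diag d v"
  and diag_diag: "diag d (diag d' v) = diag (\<lambda>n. d n * d' n) v"
  by (simp_all add: weight_vec_simps algebra_simps)

text \<open>
  The conditions on \<open>\<kappa>\<close> and \<open>\<epsilon>\<close> are those under which the operators below satisfy the relations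
  of \<open>U\<close>; \<open>\<epsilon> n\<close> is the eigenvalue of \<open>\<xi>\<close> at \<open>v\<^sub>n\<close>.
\<close>

locale weight_string =
  fixes q :: complex and m :: nat and \<kappa> \<epsilon> :: "int \<Rightarrow> complex"
  assumes \<kappa>_nonzero: "\<kappa> n \<noteq> 0"
    and \<kappa>_step: "\<kappa> (n + 1) = q\<^sup>2 * \<kappa> n"
    and \<epsilon>_step: "\<epsilon> (n + 1) = \<epsilon> n - (\<kappa> n ^ m - inverse (\<kappa> n) ^ m) / (q - inverse q)"
begin

fun gen_act :: "gen \<Rightarrow> weight_vec \<Rightarrow> weight_vec" where
  "gen_act gen_E v = shift 1 v"
| "gen_act gen_F v = shift (-1) (diag \<epsilon> v)"
| "gen_act gen_K v = diag \<kappa> v"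
| "gen_act gen_Kinv v = diag (\<lambda>n. inverse (\<kappa> n)) v"

fun word_act :: "word \<Rightarrow> weight_vec \<Rightarrow> weight_vec"
  where "word_act (Word gs) v = foldr gen_act gs v"

definition act :: "free_alg \<Rightarrow> weight_vec \<Rightarrow> weight_vec"
  where "act a v = (\<Sum>w\<in>Poly_Mapping.keys a. scale (poly_mapping.lookup a w) (word_act w v))"

lemma word_act_zero [simp]: "word_act 0 v = v"
  by (simp add: zero_word_def)

lemma act_single: "act (Poly_Mapping.single w c) v = scale c (word_act w v)"
  by (auto simp: act_def weight_vec_simps)

lemma act_add: "act (a + b) v = act a v + act b v"
  unfolding act_def
  by (rule setsum_keys_plus_distrib) (simp_all add: weight_vec_simps algebra_simps)

lemma gen_act_add: "gen_act g (u + v) = gen_act g u + gen_act g v"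
  and gen_act_scale: "gen_act g (scale c v) = scale c (gen_act g v)"
  by (cases g; simp add: weight_vec_simps algebra_simps)+

lemma act_scalar [simp]: "act (free_scalar c) v = scale c v"
  by (simp add: free_scalar_def act_single)

lemma act_zero [simp]: "act 0 v = 0"
  by (simp add: act_def)

lemma act_one [simp]: "act 1 v = v"
  using act_scalar[of 1 v] by (simp add: free_scalar_simps weight_vec_simps)

lemma act_gen_mult: "act (free_gen g * a) v = gen_act g (act a v)"
proof (induction a rule: poly_mapping_single_induct)
  case (single w c)
  then show ?case
    by (cases w) (simp add: free_gen_def mult_single act_single gen_act_scale)
qed (simp add: distrib_left act_add gen_act_add)

lemma act_gen [simp]: "act (free_gen g) v = gen_act g v"
  using act_gen_mult[of g 1 v] by simp

lemma act_mult: "act (a * b) v = act a (act b v)"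
proof (induction a rule: free_alg_induct)
  case (scalar c)
  show ?case
  proof (induction b rule: poly_mapping_single_induct)
    case (single w d)
    then show ?case
      by (simp add: free_scalar_def mult_single act_single diag_diag)
  qed (simp_all add: distrib_left act_add diag_add)
qed (simp_all add: distrib_right act_add act_gen_mult mult.assoc)

lemma act_minus: "act (a - b) v = act a v - act b v"
  using act_add[of "a - b" b v] by simp

lemma act_vec_add: "act a (u + v) = act a u + act a v"
  by (induction a rule: free_alg_induct)
    (simp_all add: act_add act_mult gen_act_add diag_add)

lemma act_vec_scale: "act a (scale c v) = scale c (act a v)"
  by (induction a rule: free_alg_induct)
    (simp_all add: act_add act_mult gen_act_scale diag_add diag_diag mult.commute)

lemma act_vec_zero [simp]: "act a 0 = 0"
  using act_vec_add[of a 0 0] by simp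

lemma lookup_act_K_power:
  "poly_mapping.lookup (act (free_gen gen_K ^ k) v) n = \<kappa> n ^ k * poly_mapping.lookup v n"
  "poly_mapping.lookup (act (free_gen gen_Kinv ^ k) v) n = inverse (\<kappa> n) ^ k * poly_mapping.lookup v n"
  by (induction k) (simp_all add: act_mult)

text \<open>
  The right-hand side is the operator \<open>EF - FE\<close>: \<open>EF\<close> and \<open>FE\<close> are diagonal with entries \<open>\<epsilon> n\<close> and
  \<open>\<epsilon> (n + 1)\<close>.
\<close>

lemma act_f_K: "act (f_K q m) v = diag (\<lambda>n. \<epsilon> n - \<epsilon> (n + 1)) v"
  by (simp add: f_K_def act_mult act_minus weight_vec_simps lookup_act_K_power \<epsilon>_step
    diff_divide_distrib algebra_simps)

lemma \<kappa>_prev: "\<kappa> (n - 1) = q powi (-2) * \<kappa> n"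
proof -
  have "\<kappa> n = q\<^sup>2 * \<kappa> (n - 1)"
    using \<kappa>_step[of "n - 1"] by simp
  then show ?thesis
    using \<kappa>_nonzero[of n] by (simp add: power_int_minus)
qed

lemma act_relator:
  assumes "r \<in> U_relators q m"
  shows "act r v = 0"
proof -
  have K_E: "\<kappa> n = q\<^sup>2 * \<kappa> (n - 1)" for n
    using \<kappa>_step[of "n - 1"] by simp
  have K_F: "\<kappa> n * x = q powi (-2) * (\<kappa> (n + 1) * x)" for n x
    using \<kappa>_prev[of "n + 1"] by simp
  show ?thesis
    using assms unfolding U_relators_def Let_def
  proof (elim insertE emptyE)
    assume r: "r = free_gen gen_K * free_gen gen_E
      - free_scalar (q powi 2) * free_gen gen_E * free_gen gen_K"
    show ?thesis
      unfolding r by (simp add: act_minus act_mult weight_vec_simps) (use K_E in blast)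
  next
    assume r: "r = free_gen gen_K * free_gen gen_F
      - free_scalar (q powi (-2)) * free_gen gen_F * free_gen gen_K"
    show ?thesis
      unfolding r using K_F by (simp add: act_minus act_mult weight_vec_simps mult.left_commute del: power_int_minus)
  next
    assume r: "r = free_gen gen_E * free_gen gen_F - free_gen gen_F * free_gen gen_E - f_K q m"
    show ?thesis
      unfolding r by (simp add: act_minus act_add act_mult weight_vec_simps act_f_K algebra_simps)
  next
    assume r: "r = free_gen gen_K * free_gen gen_Kinv - 1"
    show ?thesis
      unfolding r by (simp add: act_minus act_mult weight_vec_simps \<kappa>_nonzero)
  next
    assume r: "r = free_gen gen_Kinv * free_gen gen_K - 1"
    show ?thesis
      unfolding r by (simp add: act_minus act_mult weight_vec_simps \<kappa>_nonzero)
  qed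
qed

text \<open>
  The action descends to \<open>U\<close>: the elements of the free algebra acting as zero form a two-sided ideal
  that contains the relators.
\<close>

lemma act_U_ideal:
  assumes "a \<in> U_ideal q m"
  shows "act a v = 0"
proof -
  have "ideal {a. \<forall>v. act a v = 0} free_ring"
  proof (rule idealI[OF ring_free_ring])
    show "subgroup {a. \<forall>v. act a v = 0} (add_monoid free_ring)"
      using act_minus[of 0]
      by (intro free.add.subgroupI) (auto simp: act_add a_inv_def[symmetric] intro: exI[of _ 0])
  qed (auto simp: act_mult)
  then have "U_ideal q m \<subseteq> {a. \<forall>v. act a v = 0}"
    unfolding U_ideal_def by (rule free.genideal_minimal) (auto simp: act_relator)
  with assms show ?thesis by auto
qed

end


section \<open>Weight vectors modulo a left ideal\<close>

lemma free_scalar_mult_left: "free_scalar c * (free_scalar d * a) = free_scalar (c * d) * a"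
  by (simp add: free_scalar_simps flip: mult.assoc)

text \<open>
  Think of \<open>J\<close> as the preimage of \<open>UP\<close> in the free algebra. Modulo \<open>J\<close> the element \<open>1\<close> behaves like
  \<open>v\<^sub>0\<close>, being an eigenvector of \<open>K\<close> and of \<open>\<xi>\<close>, and this is enough to recover the whole string.
\<close>

locale weight_left_ideal = weight_string +
  fixes J :: "free_alg set"
  assumes \<epsilon>_nonzero: "\<epsilon> n \<noteq> 0"
    and J_add: "a \<in> J \<Longrightarrow> b \<in> J \<Longrightarrow> a + b \<in> J"
    and J_mult: "a \<in> J \<Longrightarrow> b * a \<in> J"
    and U_ideal_J: "U_ideal q m \<subseteq> J"
    and xi_J: "free_gen gen_E * free_gen gen_F - free_scalar (\<epsilon> 0) \<in> J"
    and K_J: "free_gen gen_K - free_scalar (\<kappa> 0) \<in> J"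
begin

definition cong :: "free_alg \<Rightarrow> free_alg \<Rightarrow> bool"  (infix \<open>\<asymp>\<close> 50)
  where "a \<asymp> b \<longleftrightarrow> a - b \<in> J"

lemma cong_refl [simp]: "a \<asymp> a"
  using J_mult[OF K_J, of 0] by (simp add: cong_def)

lemma cong_sym: "a \<asymp> b \<Longrightarrow> b \<asymp> a"
  using J_mult[of "a - b" "-1"] by (simp add: cong_def)

lemma cong_trans [trans]: "a \<asymp> b \<Longrightarrow> b \<asymp> c \<Longrightarrow> a \<asymp> c"
  using J_add[of "a - b" "b - c"] by (simp add: cong_def)

lemma cong_mult: "a \<asymp> b \<Longrightarrow> c * a \<asymp> c * b"
  using J_mult[of "a - b" c] by (simp add: cong_def right_diff_distrib)

lemma cong_add: "a \<asymp> b \<Longrightarrow> c \<asymp> d \<Longrightarrow> a + c \<asymp> b + d"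
  using J_add[of "a - b" "c - d"] by (simp add: cong_def add_diff_add)

lemma cong_diff: "a \<asymp> b \<Longrightarrow> c \<asymp> d \<Longrightarrow> a - c \<asymp> b - d"
  using cong_add[of a b "-1 * c" "-1 * d"] cong_mult[of c d "-1"] by simp

text \<open>
  A left ideal need not absorb factors on the right; relators may nevertheless be multiplied on the
  right, because \<open>J\<close> contains the whole two-sided ideal that they generate. This makes the relations
  of \<open>U\<close> available in front of an arbitrary element.
\<close>

lemma relator_J: "r \<in> U_relators q m \<Longrightarrow> r * x \<in> J"
  using ideal.I_r_closed[OF ideal_U_ideal, of r q m x] U_relators_subset U_ideal_J by auto

lemma K_E_cong:
  "free_gen gen_K * (free_gen gen_E * x) \<asymp> free_scalar (q powi 2) * (free_gen gen_E * (free_gen gen_K * x))"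
  unfolding cong_def
  using relator_J[of "free_gen gen_K * free_gen gen_E
      - free_scalar (q powi 2) * free_gen gen_E * free_gen gen_K" x]
  by (simp add: U_relators_def Let_def left_diff_distrib mult.assoc)

lemma K_F_cong:
  "free_gen gen_K * (free_gen gen_F * x) \<asymp> free_scalar (q powi (-2)) * (free_gen gen_F * (free_gen gen_K * x))"
  unfolding cong_def
  using relator_J[of "free_gen gen_K * free_gen gen_F
      - free_scalar (q powi (-2)) * free_gen gen_F * free_gen gen_K" x]
  by (simp add: U_relators_def Let_def left_diff_distrib mult.assoc)

lemma Kinv_K_cong: "free_gen gen_Kinv * (free_gen gen_K * x) \<asymp> x"
  unfolding cong_def
  using relator_J[of "free_gen gen_Kinv * free_gen gen_K - 1" x]
  by (simp add: U_relators_def Let_def left_diff_distrib mult.assoc)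

lemma E_F_cong:
  "free_gen gen_F * (free_gen gen_E * x) \<asymp> free_gen gen_E * (free_gen gen_F * x) - f_K q m * x"
  by (rule cong_sym, unfold cong_def)
    (use relator_J[of "free_gen gen_E * free_gen gen_F - free_gen gen_F * free_gen gen_E - f_K q m" x]
      in \<open>simp add: U_relators_def Let_def left_diff_distrib mult.assoc algebra_simps\<close>)

definition has_weight :: "int \<Rightarrow> free_alg \<Rightarrow> bool"
  where "has_weight n x \<longleftrightarrow> free_gen gen_K * x \<asymp> free_scalar (\<kappa> n) * x \<and>
    free_gen gen_E * (free_gen gen_F * x) \<asymp> free_scalar (\<epsilon> n) * x"

lemma Kinv_weight:
  assumes "free_gen gen_K * x \<asymp> free_scalar (\<kappa> n) * x"
  shows "free_gen gen_Kinv * x \<asymp> free_scalar (inverse (\<kappa> n)) * x"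
proof -
  have "x = free_scalar (inverse (\<kappa> n)) * (free_scalar (\<kappa> n) * x)"
    by (simp add: free_scalar_mult_left \<kappa>_nonzero free_scalar_simps)
  also have "\<dots> \<asymp> free_scalar (inverse (\<kappa> n)) * (free_gen gen_K * x)"
    by (intro cong_mult cong_sym[OF assms])
  finally have "free_gen gen_Kinv * x \<asymp>
      free_gen gen_Kinv * (free_scalar (inverse (\<kappa> n)) * (free_gen gen_K * x))"
    by (rule cong_mult)
  also have "\<dots> = free_scalar (inverse (\<kappa> n)) * (free_gen gen_Kinv * (free_gen gen_K * x))"
    by (rule free_scalar_left_commute)
  also have "\<dots> \<asymp> free_scalar (inverse (\<kappa> n)) * x"
    by (intro cong_mult Kinv_K_cong)
  finally show ?thesis .
qed

lemma cong_power:
  assumes "a * x \<asymp> free_scalar c * x"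
  shows "a ^ k * x \<asymp> free_scalar (c ^ k) * x"
proof (induction k)
  case (Suc k)
  have "a ^ Suc k * x = a * (a ^ k * x)"
    by (simp add: mult.assoc)
  also have "\<dots> \<asymp> a * (free_scalar (c ^ k) * x)"
    by (rule cong_mult[OF Suc])
  also have "\<dots> = free_scalar (c ^ k) * (a * x)"
    by (rule free_scalar_left_commute)
  also have "\<dots> \<asymp> free_scalar (c ^ k) * (free_scalar c * x)"
    by (rule cong_mult[OF assms])
  also have "\<dots> = free_scalar (c ^ Suc k) * x"
    by (simp add: free_scalar_mult_left mult.commute)
  finally show ?case .
qed (simp add: free_scalar_simps)

text \<open>
  By the recursion for \<open>\<epsilon>\<close>, the value of \<open>f\<^sub>m\<close> at \<open>\<kappa> n\<close> is \<open>\<epsilon> n - \<epsilon> (n + 1)\<close>. Hence \<open>FE = EF - f\<^sub>m(K)\<close> has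
  eigenvalue \<open>\<epsilon> (n + 1)\<close> where \<open>EF\<close> has \<open>\<epsilon> n\<close>, and \<open>E\<close> and \<open>F\<close> shift the weight by one.
\<close>

lemma f_K_weight:
  assumes "free_gen gen_K * x \<asymp> free_scalar (\<kappa> n) * x"
  shows "f_K q m * x \<asymp> free_scalar (\<epsilon> n - \<epsilon> (n + 1)) * x"
proof -
  have "f_K q m * x = free_scalar (1 / (q - inverse q)) *
      (free_gen gen_K ^ m * x - free_gen gen_Kinv ^ m * x)"
    by (simp add: f_K_def mult.assoc left_diff_distrib)
  also have "\<dots> \<asymp> free_scalar (1 / (q - inverse q)) *
      (free_scalar (\<kappa> n ^ m) * x - free_scalar (inverse (\<kappa> n) ^ m) * x)"
    by (intro cong_mult cong_diff cong_power assms Kinv_weight)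
  also have "\<dots> = free_scalar (1 / (q - inverse q) * (\<kappa> n ^ m - inverse (\<kappa> n) ^ m)) * x"
    by (simp only: free_scalar_simps mult.assoc flip: left_diff_distrib)
      (simp only: free_scalar_simps flip: mult.assoc)
  also have "1 / (q - inverse q) * (\<kappa> n ^ m - inverse (\<kappa> n) ^ m) = \<epsilon> n - \<epsilon> (n + 1)"
    by (simp add: \<epsilon>_step)
  finally show ?thesis .
qed

lemma has_weight_F_E:
  assumes "has_weight n x"
  shows "free_gen gen_F * (free_gen gen_E * x) \<asymp> free_scalar (\<epsilon> (n + 1)) * x"
proof -
  note E_F_cong
  also have "free_gen gen_E * (free_gen gen_F * x) - f_K q m * x \<asymp>
      free_scalar (\<epsilon> n) * x - free_scalar (\<epsilon> n - \<epsilon> (n + 1)) * x"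
    using assms f_K_weight[of x n] by (intro cong_diff) (simp_all add: has_weight_def)
  also have "\<dots> = free_scalar (\<epsilon> (n + 1)) * x"
    by (simp add: free_scalar_simps flip: left_diff_distrib)
  finally show ?thesis .
qed

lemma has_weight_E:
  assumes "has_weight n x"
  shows "has_weight (n + 1) (free_gen gen_E * x)"
  unfolding has_weight_def
proof
  note K_E_cong
  also have "free_scalar (q powi 2) * (free_gen gen_E * (free_gen gen_K * x)) \<asymp>
      free_scalar (q powi 2) * (free_gen gen_E * (free_scalar (\<kappa> n) * x))"
    using assms by (intro cong_mult) (simp add: has_weight_def)
  also have "\<dots> = free_scalar (\<kappa> (n + 1)) * (free_gen gen_E * x)"
    by (simp add: free_scalar_left_commute[of "free_gen _"] free_scalar_mult_left \<kappa>_step)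
  finally show "free_gen gen_K * (free_gen gen_E * x) \<asymp> free_scalar (\<kappa> (n + 1)) * (free_gen gen_E * x)" .
  have "free_gen gen_E * (free_gen gen_F * (free_gen gen_E * x)) \<asymp>
      free_gen gen_E * (free_scalar (\<epsilon> (n + 1)) * x)"
    by (intro cong_mult has_weight_F_E assms)
  then show "free_gen gen_E * (free_gen gen_F * (free_gen gen_E * x)) \<asymp>
      free_scalar (\<epsilon> (n + 1)) * (free_gen gen_E * x)"
    by (simp only: free_scalar_left_commute)
qed

lemma has_weight_F:
  assumes "has_weight n x"
  shows "has_weight (n - 1) (free_gen gen_F * x)"
proof -
  note K_F_cong
  also have "free_scalar (q powi (-2)) * (free_gen gen_F * (free_gen gen_K * x)) \<asymp>
      free_scalar (q powi (-2)) * (free_gen gen_F * (free_scalar (\<kappa> n) * x))"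
    using assms by (intro cong_mult) (simp add: has_weight_def)
  also have "\<dots> = free_scalar (\<kappa> (n - 1)) * (free_gen gen_F * x)"
    by (simp only: free_scalar_left_commute[of "free_gen _"] free_scalar_mult_left \<kappa>_prev)
  finally have K: "free_gen gen_K * (free_gen gen_F * x) \<asymp> free_scalar (\<kappa> (n - 1)) * (free_gen gen_F * x)" .
  have "free_gen gen_E * (free_gen gen_F * (free_gen gen_F * x)) - free_scalar (\<epsilon> (n - 1) - \<epsilon> n) * (free_gen gen_F * x)
      \<asymp> free_gen gen_E * (free_gen gen_F * (free_gen gen_F * x)) - f_K q m * (free_gen gen_F * x)"
    using cong_sym[OF f_K_weight[OF K]] by (intro cong_diff) simp_all
  also have "\<dots> \<asymp> free_gen gen_F * (free_gen gen_E * (free_gen gen_F * x))"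
    by (rule cong_sym[OF E_F_cong])
  also have "\<dots> \<asymp> free_gen gen_F * (free_scalar (\<epsilon> n) * x)"
    using assms by (intro cong_mult) (simp add: has_weight_def)
  also have "\<dots> = free_scalar (\<epsilon> n) * (free_gen gen_F * x)"
    by (rule free_scalar_left_commute)
  also have "\<dots> = free_scalar (\<epsilon> (n - 1)) * (free_gen gen_F * x)
      - free_scalar (\<epsilon> (n - 1) - \<epsilon> n) * (free_gen gen_F * x)"
    by (simp add: free_scalar_simps flip: left_diff_distrib)
  finally have "free_gen gen_E * (free_gen gen_F * (free_gen gen_F * x)) \<asymp>
      free_scalar (\<epsilon> (n - 1)) * (free_gen gen_F * x)"
    by (simp add: cong_def)
  with K show ?thesis
    by (simp add: has_weight_def)
qed

lemma has_weight_scalar: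
  assumes "has_weight n x"
  shows "has_weight n (free_scalar c * x)"
  using assms cong_mult[of _ _ "free_scalar c"]
  unfolding has_weight_def free_scalar_left_commute[of "free_gen _"]
    free_scalar_left_commute[of "free_scalar (\<kappa> n)"] free_scalar_left_commute[of "free_scalar (\<epsilon> n)"]
  by blast

text \<open>
  The preimage of \<open>v\<^sub>-\<^sub>k\<close>: since \<open>F v\<^sub>n = \<epsilon>(n) v\<^sub>n\<^sub>-\<^sub>1\<close>, the power \<open>F\<^sup>k\<close> has to be divided by the product of
  \<open>\<epsilon> 0, \<dots>, \<epsilon> (1 - k)\<close>.
\<close>

primrec lowering :: "nat \<Rightarrow> free_alg" where
  "lowering 0 = 1"
| "lowering (Suc k) = free_scalar (inverse (\<epsilon> (- int k))) * (free_gen gen_F * lowering k)"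

definition basis_lift :: "int \<Rightarrow> free_alg"
  where "basis_lift n = (if 0 \<le> n then free_gen gen_E ^ nat n else lowering (nat (- n)))"

lemma basis_lift_of_nat: "basis_lift (int k) = free_gen gen_E ^ k"
  and basis_lift_uminus: "basis_lift (- int k) = lowering k"
  by (auto simp: basis_lift_def)

lemma has_weight_basis_lift: "has_weight n (basis_lift n)"
proof -
  have zero: "has_weight 0 1"
    using K_J xi_J by (simp add: has_weight_def cong_def)
  have "has_weight (int k) (free_gen gen_E ^ k)" for k
    using zero by (induction k) (auto dest: has_weight_E simp: add.commute)
  moreover have "has_weight (- int k) (lowering k)" for k
  proof (induction k)
    case (Suc k)
    have "- int (Suc k) = - int k - 1" by simp
    then show ?case
      using has_weight_scalar[OF has_weight_F[OF Suc]] by (simp only: lowering.simps)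
  qed (use zero in simp)
  ultimately show ?thesis
    by (cases n rule: int_cases2) (simp_all add: basis_lift_of_nat basis_lift_uminus)
qed

lemma E_basis_lift: "free_gen gen_E * basis_lift n \<asymp> basis_lift (n + 1)"
proof (cases "0 \<le> n")
  case True
  then show ?thesis
    by (simp add: basis_lift_def nat_add_distrib)
next
  case False
  define k where "k = nat (- n - 1)"
  have n: "n = - int (Suc k)" "n + 1 = - int k"
    using False by (simp_all add: k_def)
  have "free_gen gen_E * basis_lift n =
      free_scalar (inverse (\<epsilon> (- int k))) * (free_gen gen_E * (free_gen gen_F * basis_lift (- int k)))"
    unfolding n(1) basis_lift_uminus by (simp only: lowering.simps free_scalar_left_commute[of "free_gen _"])
  also have "\<dots> \<asymp> free_scalar (inverse (\<epsilon> (- int k))) * (free_scalar (\<epsilon> (- int k)) * basis_lift (- int k))"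
    using has_weight_basis_lift[of "- int k"] by (intro cong_mult) (simp add: has_weight_def)
  also have "\<dots> = basis_lift (n + 1)"
    unfolding n(2) by (simp add: free_scalar_mult_left \<epsilon>_nonzero free_scalar_simps)
  finally show ?thesis .
qed

lemma F_basis_lift: "free_gen gen_F * basis_lift n \<asymp> free_scalar (\<epsilon> n) * basis_lift (n - 1)"
proof (cases "0 < n")
  case True
  then have "basis_lift n = free_gen gen_E * basis_lift (n - 1)"
    by (simp add: basis_lift_def nat_diff_distrib flip: power_Suc)
  then show ?thesis
    using has_weight_F_E[OF has_weight_basis_lift[of "n - 1"]] by simp
next
  case False
  define k where "k = nat (- n)"
  have n: "n = - int k" "n - 1 = - int (Suc k)"
    using False by (simp_all add: k_def)
  have "free_scalar (\<epsilon> n) * basis_lift (n - 1) = free_gen gen_F * basis_lift n"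
    unfolding n(2) basis_lift_uminus
    by (simp add: n(1) basis_lift_uminus free_scalar_mult_left \<epsilon>_nonzero free_scalar_simps)
  then show ?thesis by simp
qed

definition vec_lift :: "weight_vec \<Rightarrow> free_alg"
  where "vec_lift v = (\<Sum>n\<in>Poly_Mapping.keys v. free_scalar (poly_mapping.lookup v n) * basis_lift n)"

lemma vec_lift_single: "vec_lift (Poly_Mapping.single n c) = free_scalar c * basis_lift n"
  by (simp add: vec_lift_def free_scalar_simps)

lemma vec_lift_add: "vec_lift (u + v) = vec_lift u + vec_lift v"
  unfolding vec_lift_def
  by (rule setsum_keys_plus_distrib)
    (simp_all add: free_scalar_simps distrib_right flip: free_scalar_simps(2))

text \<open>
  The linear map sending \<open>v\<^sub>n\<close> to \<open>basis_lift n\<close> commutes with the generators modulo \<open>J\<close>. It suffices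
  to see this on the basis, where it is the content of the preceding lemmas.
\<close>

lemma gen_mult_vec_lift: "free_gen g * vec_lift v \<asymp> vec_lift (gen_act g v)"
proof (induction v rule: poly_mapping_single_induct)
  case (single n c)
  have "free_gen g * basis_lift n \<asymp> vec_lift (gen_act g (Poly_Mapping.single n 1))"
    using E_basis_lift F_basis_lift has_weight_basis_lift[of n] Kinv_weight[of "basis_lift n" n]
    by (cases g) (simp_all add: vec_lift_single free_scalar_simps has_weight_def)
  then have "free_scalar c * (free_gen g * basis_lift n) \<asymp>
      free_scalar c * vec_lift (gen_act g (Poly_Mapping.single n 1))"
    by (rule cong_mult)
  also have "\<dots> = vec_lift (gen_act g (Poly_Mapping.single n c))"
    by (cases g) (simp_all add: vec_lift_single free_scalar_mult_left mult.commute)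
  finally show ?case
    by (simp add: vec_lift_single free_scalar_left_commute[of "free_gen _"])
next
  case (add u v)
  then show ?case
    by (simp add: vec_lift_add gen_act_add distrib_left cong_add)
qed

text \<open>
  Modulo \<open>J\<close>, an element is determined by what it does to \<open>v\<^sub>0\<close>. Here \<open>v\<^sub>0\<close> is written \<open>1\<close>, the unit
  of the convolution algebra, which is the finitely supported function with value 1 at 0.
\<close>

lemma cong_vec_lift: "a \<asymp> vec_lift (act a 1)"
proof (induction a rule: free_alg_induct)
  case (scalar c)
  then show ?case by (simp add: vec_lift_single basis_lift_def)
next
  case (add a b)
  then show ?case by (simp add: act_add vec_lift_add cong_add)
next
  case (gen g a)
  have "free_gen g * a \<asymp> free_gen g * vec_lift (act a 1)"
    by (rule cong_mult[OF gen])
  also note gen_mult_vec_lift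
  finally show ?case by (simp add: act_mult)
qed

lemma annihilator_subset: "act a 1 = 0 \<Longrightarrow> a \<in> J"
  using cong_vec_lift[of a] by (simp add: cong_def vec_lift_def)

end


section \<open>The quotient module as the space of finitely supported vectors\<close>

locale regular_weight_string = weight_string +
  assumes \<epsilon>_nonzero: "\<epsilon> n \<noteq> 0"
    and \<kappa>_inj: "inj \<kappa>"
begin

abbreviation v0 :: weight_vec
  where "v0 \<equiv> 1"

text \<open>
  A nonzero vector of minimal support in an invariant subspace is a multiple of some \<open>v\<^sub>n\<close>: otherwise
  subtracting \<open>\<kappa> n\<close> times the vector from its image under \<open>K\<close> removes one index \<open>n\<close> of the support
  and, the weights being distinct, no other. From \<open>v\<^sub>n\<close> the operators \<open>E\<close> and \<open>F\<close> reach all of the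
  basis, as no \<open>\<epsilon> i\<close> vanishes.
\<close>

lemma invariant_subspace_trivial:
  assumes add: "\<And>u v. u \<in> W \<Longrightarrow> v \<in> W \<Longrightarrow> u + v \<in> W"
    and gen: "\<And>g v. v \<in> W \<Longrightarrow> gen_act g v \<in> W"
    and scale: "\<And>c v. v \<in> W \<Longrightarrow> scale c v \<in> W"
    and "v \<in> W" "v \<noteq> 0"
  shows "W = UNIV"
proof -
  have "\<exists>n. Poly_Mapping.single n 1 \<in> W"
    using \<open>v \<in> W\<close> \<open>v \<noteq> 0\<close>
  proof (induction "card (Poly_Mapping.keys v)" arbitrary: v rule: less_induct)
    case less
    obtain n where n: "n \<in> Poly_Mapping.keys v"
      using less.prems by fastforce
    define u where "u = diag \<kappa> v + scale (- \<kappa> n) v"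
    have u: "poly_mapping.lookup u i = (\<kappa> i - \<kappa> n) * poly_mapping.lookup v i" for i
      by (simp add: u_def lookup_add algebra_simps)
    have "u \<in> W"
      using less.prems gen[of v gen_K] by (auto simp: u_def intro: add scale)
    have keys_u: "Poly_Mapping.keys u = Poly_Mapping.keys v - {n}"
      using injD[OF \<kappa>_inj] by (auto simp: in_keys_iff u)
    show ?case
    proof (cases "u = 0")
      case False
      then show ?thesis
        using less.hyps[of u] card_Diff1_less[OF _ n] \<open>u \<in> W\<close> by (simp add: keys_u)
    next
      case True
      then have "poly_mapping.lookup v i = 0" if "i \<noteq> n" for i
        using that keys_u by (auto simp: in_keys_iff)
      then have "scale (inverse (poly_mapping.lookup v n)) v = Poly_Mapping.single n 1"
        using n by (auto simp: weight_vec_simps lookup_single when_def in_keys_iff)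
      then show ?thesis
        using scale[OF less.prems(1)] by metis
    qed
  qed
  then obtain n where n: "Poly_Mapping.single n 1 \<in> W"
    by blast
  have up: "Poly_Mapping.single (i + 1) 1 \<in> W" if "Poly_Mapping.single i 1 \<in> W" for i
    using gen[OF that, of gen_E] by simp
  have down: "Poly_Mapping.single (i - 1) 1 \<in> W" if "Poly_Mapping.single i 1 \<in> W" for i
    using scale[OF gen[OF that, of gen_F], of "inverse (\<epsilon> i)"] by (simp add: \<epsilon>_nonzero)
  have single: "Poly_Mapping.single i 1 \<in> W" for i
    by (induction i rule: int_induct[of _ n]) (auto intro: n up down)
  have "Poly_Mapping.single i c \<in> W" for i c
    using scale[OF single, of c i] by simp
  then have "u \<in> W" for u
    by (induction u rule: poly_mapping_single_induct) (auto intro: add)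
  then show ?thesis by blast
qed

lemma act_v0_surj: "\<exists>a. act a v0 = v"
proof -
  have "range (\<lambda>a. act a v0) = UNIV"
  proof (rule invariant_subspace_trivial)
    show "u + v \<in> range (\<lambda>a. act a v0)"
      if "u \<in> range (\<lambda>a. act a v0)" "v \<in> range (\<lambda>a. act a v0)" for u v
      using that by (auto simp flip: act_add)
    show "gen_act g v \<in> range (\<lambda>a. act a v0)" if "v \<in> range (\<lambda>a. act a v0)" for g v
      using that by (auto simp flip: act_gen_mult)
    show "scale c v \<in> range (\<lambda>a. act a v0)" if "v \<in> range (\<lambda>a. act a v0)" for c v
      using that by (auto simp flip: act_scalar act_mult)
    show "v0 \<in> range (\<lambda>a. act a v0)"
      using act_one[of v0] by (metis rangeI)
  qed simp
  then show ?thesis by (metis rangeE UNIV_I)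
qed

text \<open>
  The line through \<open>v\<^sub>0\<close> is stable under the generators of \<open>R\<close>.
\<close>

lemma R_alg_scalar:
  assumes "r \<in> carrier (R_alg q m)"
  shows "\<exists>a c. r = U_class q m a \<and> act a v0 = scale c v0"
proof -
  have "r \<in> generate_ring (U_alg q m) (range (U_scalar q m) \<union> {U_xi q m, U_gen q m gen_K, U_gen q m gen_Kinv})"
    using assms by (simp add: R_alg_def)
  then show ?thesis
  proof induction
    case one
    show ?case
      by (intro exI[of _ 1]) (simp add: U_class_simps)
  next
    case (incl h)
    then consider c where "h = U_class q m (free_scalar c)"
      | "h = U_class q m (free_gen gen_E * free_gen gen_F)"
      | "h = U_class q m (free_gen gen_K)" | "h = U_class q m (free_gen gen_Kinv)"
      by (auto simp: U_gen_class U_scalar_class U_xi_class)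
    then show ?case
    proof cases
      case 1
      then show ?thesis by (metis act_scalar)
    qed (force simp: act_mult)+
  next
    case (a_inv h)
    then obtain a c where "h = U_class q m a" "act a v0 = scale c v0" by blast
    then show ?case
      using act_minus[of 0 a v0]
      by (intro exI[of _ "- a"] exI[of _ "- c"]) (auto simp: U_class_simps single_uminus)
  next
    case (eng_add h1 h2)
    then obtain a b c d where "h1 = U_class q m a" "act a v0 = scale c v0"
      "h2 = U_class q m b" "act b v0 = scale d v0" by blast
    then show ?case
      by (intro exI[of _ "a + b"] exI[of _ "c + d"]) (auto simp: U_class_simps act_add single_add)
  next
    case (eng_mult h1 h2)
    then obtain a b c d where ab: "h1 = U_class q m a" "act a v0 = scale c v0"
      "h2 = U_class q m b" "act b v0 = scale d v0" by blast
    then have "act (a * b) v0 = scale (d * c) v0"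
      by (simp only: act_mult act_vec_scale diag_diag)
    with ab show ?case
      by (intro exI[of _ "a * b"] exI[of _ "d * c"]) (auto simp: U_class_simps)
  qed
qed

abbreviation P :: "U_elem set"
  where "P \<equiv> M_ideal q m (\<epsilon> 0) (\<kappa> 0)"

text \<open>
  Because \<open>R\<close> acts on \<open>v\<^sub>0\<close> by scalars, the annihilator of \<open>v\<^sub>0\<close> in \<open>R\<close> is closed under
  multiplication by \<open>R\<close> on both sides; it contains the generators of \<open>P\<close>.
\<close>

lemma M_ideal_annihilates: "P \<subseteq> U_class q m ` {a. act a v0 = 0}"
proof -
  let ?A = "{r \<in> carrier (R_alg q m). r \<in> U_class q m ` {a. act a v0 = 0}}"
  interpret R: ring "R_alg q m"
    by (rule ring_R_alg)
  have ops: "x \<oplus>\<^bsub>R_alg q m\<^esub> y = x \<oplus>\<^bsub>U_alg q m\<^esub> y" "x \<otimes>\<^bsub>R_alg q m\<^esub> y = x \<otimes>\<^bsub>U_alg q m\<^esub> y"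
    "\<zero>\<^bsub>R_alg q m\<^esub> = \<zero>\<^bsub>U_alg q m\<^esub>" for x y
    by (simp_all add: R_alg_def)
  have "ideal ?A (R_alg q m)"
  proof (rule idealI[OF ring_R_alg])
    show "subgroup ?A (add_monoid (R_alg q m))"
    proof (rule R.add.subgroupI)
      show "?A \<noteq> {}"
        using R.zero_closed by (auto simp: ops U_class_simps intro!: exI[of _ "U_class q m 0"])
      fix x assume "x \<in> ?A"
      then obtain a where a: "x = U_class q m a" "act a v0 = 0" "x \<in> carrier (R_alg q m)"
        by auto
      have "U_class q m (- a) \<in> carrier (R_alg q m)"
        using a generate_ring.a_inv[of x "U_alg q m"] by (simp add: R_alg_def U_class_simps)
      moreover from this have "\<ominus>\<^bsub>R_alg q m\<^esub> x = U_class q m (- a)"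
        using a by (intro R.minus_equality) (simp_all add: ops U_class_simps)
      ultimately show "\<ominus>\<^bsub>R_alg q m\<^esub> x \<in> ?A"
        using a act_minus[of 0 a v0] by auto
    next
      fix x y assume "x \<in> ?A" "y \<in> ?A"
      then show "x \<oplus>\<^bsub>R_alg q m\<^esub> y \<in> ?A"
        using R.a_closed[of x y] by (auto simp: ops U_class_simps act_add)
    qed auto
  next
    fix x r assume x: "x \<in> ?A" and r: "r \<in> carrier (R_alg q m)"
    then obtain a where a: "x = U_class q m a" "act a v0 = 0"
      by auto
    obtain b c where b: "r = U_class q m b" "act b v0 = scale c v0"
      using R_alg_scalar[OF r] by blast
    have "act (b * a) v0 = 0" "act (a * b) v0 = 0"
      using a b by (simp_all only: act_mult act_vec_scale act_vec_zero) (simp add: weight_vec_simps)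
    then show "r \<otimes>\<^bsub>R_alg q m\<^esub> x \<in> ?A" "x \<otimes>\<^bsub>R_alg q m\<^esub> r \<in> ?A"
      using x r R.m_closed[of r x] R.m_closed[of x r] by (auto simp: a b ops U_class_simps)
  qed
  moreover have "{U_xi q m \<ominus>\<^bsub>U_alg q m\<^esub> U_scalar q m (\<epsilon> 0),
     U_gen q m gen_K \<ominus>\<^bsub>U_alg q m\<^esub> U_scalar q m (\<kappa> 0)} \<subseteq> ?A"
    using M_generators_R_alg
    by (auto simp: U_gen_class U_scalar_class U_xi_class U_class_simps act_minus act_mult intro!: imageI)
  ultimately have "P \<subseteq> ?A"
    unfolding M_ideal_def by (rule R.genideal_minimal)
  then show ?thesis by blast
qed

abbreviation UP :: "U_elem set"
  where "UP \<equiv> ideal_prod (U_alg q m) (carrier (U_alg q m)) P"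

lemma UP_annihilates: "x \<in> UP \<Longrightarrow> x \<in> U_class q m ` {a. act a v0 = 0}"
proof (induction rule: ideal_prod.induct)
  case (prod i j)
  then obtain a b where "i = U_class q m a" "j = U_class q m b" "act b v0 = 0"
    using M_ideal_annihilates by (auto simp: carrier_U_alg)
  then show ?case
    by (auto simp: U_class_simps act_mult)
next
  case (sum s1 s2)
  then show ?case
    by (auto simp: U_class_simps act_add)
qed

lemma UP_left_mult: "x \<in> UP \<Longrightarrow> U_class q m b \<otimes>\<^bsub>U_alg q m\<^esub> x \<in> UP"
proof (induction rule: ideal_prod.induct)
  case (prod i j)
  then obtain a c where ac: "i = U_class q m a" "j = U_class q m c" "j \<in> P"
    using M_ideal_annihilates by (auto simp: carrier_U_alg)
  then have "U_class q m (b * a) \<otimes>\<^bsub>U_alg q m\<^esub> j \<in> UP"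
    by (intro ideal_prod.prod) simp_all
  then show ?case
    by (simp add: ac U_class_simps mult.assoc)
next
  case (sum s1 s2)
  then obtain a c where "s1 = U_class q m a" "s2 = U_class q m c"
    using UP_annihilates by blast
  then show ?case
    using ideal_prod.sum[OF sum.IH] by (simp add: U_class_simps distrib_left)
qed

lemma UP_eq: "UP = U_class q m ` {a. act a v0 = 0}"
proof
  show "UP \<subseteq> U_class q m ` {a. act a v0 = 0}"
    using UP_annihilates by blast
  have gens: "U_class q m (free_gen gen_E * free_gen gen_F - free_scalar (\<epsilon> 0)) \<in> UP"
    "U_class q m (free_gen gen_K - free_scalar (\<kappa> 0)) \<in> UP"
    using ideal_prod.prod[where R = "U_alg q m", OF U_class_closed[of q m 1] M_generators_M_ideal(1)[of q m]]
      ideal_prod.prod[where R = "U_alg q m", OF U_class_closed[of q m 1] M_generators_M_ideal(2)[of q m]]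
    by (simp_all add: U_class_simps U_gen_class U_scalar_class U_xi_class)
  interpret J: weight_left_ideal q m \<kappa> \<epsilon> "{a. U_class q m a \<in> UP}"
  proof
    show "U_ideal q m \<subseteq> {a. U_class q m a \<in> UP}"
    proof safe
      fix a assume "a \<in> U_ideal q m"
      then have "U_class q m a = U_class q m (0 * (free_gen gen_K - free_scalar (\<kappa> 0)))"
        by (simp add: U_class_eq_iff)
      also have "\<dots> \<in> UP"
        using UP_left_mult[OF gens(2), of 0] by (simp add: U_class_simps)
      finally show "U_class q m a \<in> UP" .
    qed
    show "a + b \<in> {a. U_class q m a \<in> UP}"
      if "a \<in> {a. U_class q m a \<in> UP}" "b \<in> {a. U_class q m a \<in> UP}" for a b
      using that ideal_prod.sum[where R = "U_alg q m"] by (simp flip: U_class_simps(1))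
    show "b * a \<in> {a. U_class q m a \<in> UP}" if "a \<in> {a. U_class q m a \<in> UP}" for a b
      using that UP_left_mult[of "U_class q m a" b] by (simp add: U_class_simps)
  qed (use \<epsilon>_nonzero gens in simp_all)
  show "U_class q m ` {a. act a v0 = 0} \<subseteq> UP"
    using J.annihilator_subset by auto
qed

text \<open>
  The isomorphism from \<open>V\<close> to \<open>U/UP\<close>: as \<open>UP\<close> is the annihilator of \<open>v\<^sub>0\<close>, its cosets are the fibres of
  \<open>u \<mapsto> u v\<^sub>0\<close>, and the vector attached to a fibre is the common value.
\<close>

definition fibre :: "weight_vec \<Rightarrow> U_elem set"
  where "fibre u = U_class q m ` {a. act a v0 = u}"

lemma U_class_in_fibre: "U_class q m a \<in> fibre u \<longleftrightarrow> act a v0 = u"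
proof
  assume "U_class q m a \<in> fibre u"
  then obtain b where "a - b \<in> U_ideal q m" "act b v0 = u"
    by (auto simp: fibre_def U_class_eq_iff)
  then show "act a v0 = u"
    using act_U_ideal[of "a - b" v0] by (simp add: act_minus)
qed (auto simp: fibre_def)

lemma fibre_inj: "fibre u = fibre v \<longleftrightarrow> u = v"
  using act_v0_surj U_class_in_fibre by metis

lemma coset_UP: "UP +>\<^bsub>U_alg q m\<^esub> U_class q m a = fibre (act a v0)"
proof -
  have "b \<in> fibre (act a v0) \<Longrightarrow> b \<in> (\<lambda>x. U_class q m (x + a)) ` {a. act a v0 = 0}" for b
    by (auto simp: fibre_def act_minus intro!: image_eqI[where x = "_ - a"])
  then show ?thesis
    unfolding a_r_coset_def' UP_eq by (force simp: U_class_simps fibre_def act_add)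
qed

abbreviation M :: "(U_elem, U_elem set) module"
  where "M \<equiv> U_mod q m P"

lemma carrier_M: "carrier M = range fibre"
proof -
  have "a_rcosets\<^bsub>U_alg q m\<^esub> UP = (\<lambda>x. UP +>\<^bsub>U_alg q m\<^esub> x) ` carrier (U_alg q m)"
    by (auto simp: A_RCOSETS_def RCOSETS_def a_r_coset_def)
  then have "carrier M = range (\<lambda>a. fibre (act a v0))"
    by (simp add: U_mod_def quotient_module_def carrier_U_alg image_image coset_UP[unfolded carrier_U_alg])
  then show ?thesis
    using act_v0_surj by (metis image_image surj_def)
qed

lemma fibre_closed [simp]: "fibre u \<in> carrier M"
  by (simp add: carrier_M)

lemma zero_M: "\<zero>\<^bsub>M\<^esub> = fibre 0"
  by (simp add: U_mod_def quotient_module_def UP_eq fibre_def)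

lemma add_M: "fibre u \<oplus>\<^bsub>M\<^esub> fibre v = fibre (u + v)"
proof -
  have "fibre u \<oplus>\<^bsub>M\<^esub> fibre v = {U_class q m (a + b) |a b. act a v0 = u \<and> act b v0 = v}"
    by (auto simp: U_mod_def quotient_module_def set_add_def' fibre_def U_class_simps)
  also have "\<dots> = fibre (u + v)"
  proof -
    obtain a where a: "act a v0 = u"
      using act_v0_surj by blast
    have "x \<in> {U_class q m (a + b) |a b. act a v0 = u \<and> act b v0 = v}" if "x \<in> fibre (u + v)" for x
    proof -
      obtain c where "x = U_class q m (a + (c - a))" "act (c - a) v0 = v"
        using \<open>x \<in> fibre (u + v)\<close> a by (auto simp: fibre_def act_minus)
      with a show ?thesis by blast
    qed
    then show ?thesis
      by (auto simp: fibre_def act_add)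
  qed
  finally show ?thesis .
qed

lemma smult_M: "U_class q m a \<odot>\<^bsub>M\<^esub> fibre u = fibre (act a u)"
proof -
  have "U_class q m a \<odot>\<^bsub>M\<^esub> fibre u = (\<Union>b\<in>{b. act b v0 = u}. fibre (act (a * b) v0))"
    by (auto simp: U_mod_def quotient_module_def fibre_def U_class_simps coset_UP)
  also have "\<dots> = (\<Union>b\<in>{b. act b v0 = u}. fibre (act a u))"
    by (auto simp: act_mult)
  also have "\<dots> = fibre (act a u)"
    using act_v0_surj[of u] by auto
  finally show ?thesis .
qed

lemma abelian_group_M: "abelian_group M"
proof (rule abelian_groupI)
  show "\<exists>y\<in>carrier M. y \<oplus>\<^bsub>M\<^esub> x = \<zero>\<^bsub>M\<^esub>" if x: "x \<in> carrier M" for x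
  proof -
    obtain u where "x = fibre u"
      using x by (auto simp: carrier_M)
    then have "fibre (- u) \<oplus>\<^bsub>M\<^esub> x = \<zero>\<^bsub>M\<^esub>"
      by (simp add: add_M zero_M)
    then show ?thesis
      using fibre_closed by blast
  qed
qed (auto simp: carrier_M add_M zero_M add_ac)

lemma left_module_M: "left_module (U_alg q m) M"
proof (intro left_module.intro ring_U_alg abelian_group_M left_module_axioms.intro)
qed (auto simp: carrier_M carrier_U_alg smult_M add_M U_class_simps act_add act_mult act_vec_add)

lemma irreducible_M: "irreducible_module (U_alg q m) M"
  unfolding irreducible_module_def
proof (intro conjI allI impI)
  show "left_module (U_alg q m) M" by (rule left_module_M)
  show "carrier M \<noteq> {\<zero>\<^bsub>M\<^esub>}"
    using fibre_closed[of v0] fibre_inj[of v0 0] by (auto simp: zero_M)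
  fix N assume N: "submodule N (U_alg q m) M"
  interpret N: submodule N "U_alg q m" M by (rule N)
  have sub: "N \<subseteq> range fibre"
    using N.subset by (simp add: carrier_M)
  have act: "fibre (act a v) \<in> N" if "fibre v \<in> N" for a v
    using N.smult_closed[OF U_class_closed that] by (simp add: smult_M)
  show "N = {\<zero>\<^bsub>M\<^esub>} \<or> N = carrier M"
  proof (cases "N \<subseteq> {\<zero>\<^bsub>M\<^esub>}")
    case True
    then show ?thesis
      using N.one_closed by auto
  next
    case False
    then obtain v where v: "fibre v \<in> N" "v \<noteq> 0"
      using sub by (auto simp: zero_M)
    have "{u. fibre u \<in> N} = UNIV"
    proof (rule invariant_subspace_trivial[of _ v])
      show "u + v \<in> {u. fibre u \<in> N}" if "u \<in> {u. fibre u \<in> N}" "v \<in> {u. fibre u \<in> N}" for u v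
        using that N.m_closed[of "fibre u" "fibre v"] by (simp add: add_M)
      show "gen_act g v \<in> {u. fibre u \<in> N}" if "v \<in> {u. fibre u \<in> N}" for g v
        using that act[of v "free_gen g"] by simp
      show "scale c v \<in> {u. fibre u \<in> N}" if "v \<in> {u. fibre u \<in> N}" for c v
        using that act[of v "free_scalar c"] by simp
    qed (use v in simp_all)
    then show ?thesis
      using sub by (auto simp: carrier_M)
  qed
qed

lemma finsum_M:
  assumes "finite A"
  shows "(\<Oplus>\<^bsub>M\<^esub>x\<in>A. fibre (g x)) = fibre (\<Sum>x\<in>A. g x)"
proof -
  interpret M: abelian_group M by (rule abelian_group_M)
  show ?thesis
    using assms by induction (simp_all add: zero_M add_M)
qed

text \<open>
  Finitely many vectors of finite support leave some index uncovered, and the basis vector at that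
  index is not a combination of them.
\<close>

lemma not_finite_dimensional_M: "\<not> finite_dimensional q m M"
proof
  assume "finite_dimensional q m M"
  then obtain S where S: "finite S" "S \<subseteq> carrier M"
    and span: "\<And>v. v \<in> carrier M \<Longrightarrow> \<exists>a. v = (\<Oplus>\<^bsub>M\<^esub>s\<in>S. U_scalar q m (a s) \<odot>\<^bsub>M\<^esub> s)"
    unfolding finite_dimensional_def by blast
  define vec where "vec = inv_into UNIV fibre"
  interpret M: abelian_group M by (rule abelian_group_M)
  have vec: "fibre (vec s) = s" if "s \<in> S" for s
    using that S(2) by (auto simp: vec_def carrier_M intro!: f_inv_into_f)
  have "finite (\<Union>s\<in>S. Poly_Mapping.keys (vec s))"
    using S(1) by simp
  then obtain n where n: "n \<notin> (\<Union>s\<in>S. Poly_Mapping.keys (vec s))"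
    using infinite_UNIV_int by (metis UNIV_eq_I)
  obtain a where "fibre (Poly_Mapping.single n 1) = (\<Oplus>\<^bsub>M\<^esub>s\<in>S. U_scalar q m (a s) \<odot>\<^bsub>M\<^esub> s)"
    using span by fastforce
  also have "\<dots> = (\<Oplus>\<^bsub>M\<^esub>s\<in>S. fibre (scale (a s) (vec s)))"
  proof (rule M.finsum_cong')
    show "U_scalar q m (a s) \<odot>\<^bsub>M\<^esub> s = fibre (scale (a s) (vec s))" if "s \<in> S" for s
      using smult_M[of "free_scalar (a s)" "vec s"] vec[OF that] by (simp add: U_scalar_class)
  qed auto
  also have "\<dots> = fibre (\<Sum>s\<in>S. scale (a s) (vec s))"
    by (rule finsum_M[OF S(1)])
  finally have "Poly_Mapping.single n 1 = (\<Sum>s\<in>S. scale (a s) (vec s))"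
    by (simp add: fibre_inj)
  then have "poly_mapping.lookup (Poly_Mapping.single n 1) n =
      (\<Sum>s\<in>S. a s * poly_mapping.lookup (vec s) n)"
    by (simp add: lookup_sum)
  also have "\<dots> = 0"
    using n by (intro sum.neutral) (auto simp: in_keys_iff)
  finally show False by simp
qed

lemma weight_space_M:
  "fibre u \<in> weight_space q m M c \<longleftrightarrow> (\<forall>n. \<kappa> n \<noteq> c \<longrightarrow> poly_mapping.lookup u n = 0)"
  by (simp add: weight_space_def U_gen_class U_scalar_class smult_M fibre_inj weight_vec_simps)
    (auto simp: disj_commute)

definition component :: "weight_vec \<Rightarrow> complex \<Rightarrow> weight_vec"
  where "component v c = diag (\<lambda>n. if \<kappa> n = c then 1 else 0) v"

text \<open>
  The component of \<open>v\<close> of weight \<open>c\<close> keeps the coefficients at the indices \<open>n\<close> with \<open>\<kappa> n = c\<close>. It is the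
  only choice: in a sum of weight vectors \<open>u c\<close>, the coefficient at \<open>n\<close> can only come from
  \<open>u (\<kappa> n)\<close>.
\<close>

lemma weight_representation_M: "weight_representation q m M"
  unfolding weight_representation_def
proof (intro conjI ballI left_module_M)
  fix x assume "x \<in> carrier M"
  then obtain v where x: "x = fibre v"
    by (auto simp: carrier_M)
  let ?good = "\<lambda>w. (\<forall>c. w c \<in> weight_space q m M c) \<and> finite {c. w c \<noteq> \<zero>\<^bsub>M\<^esub>} \<and>
      x = (\<Oplus>\<^bsub>M\<^esub>c\<in>{c. w c \<noteq> \<zero>\<^bsub>M\<^esub>}. w c)"
  interpret M: abelian_group M by (rule abelian_group_M)
  have unique: "poly_mapping.lookup (\<Sum>c\<in>C. u c) n = poly_mapping.lookup (u (\<kappa> n)) n"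
    if "finite C" "\<And>c. c \<notin> C \<Longrightarrow> u c = 0" "\<And>c. fibre (u c) \<in> weight_space q m M c" for C u n
  proof -
    have "(\<Sum>c\<in>C. poly_mapping.lookup (u c) n) = (\<Sum>c\<in>C. if c = \<kappa> n then poly_mapping.lookup (u c) n else 0)"
      using that(3) by (intro sum.cong) (auto simp: weight_space_M)
    also have "\<dots> = poly_mapping.lookup (u (\<kappa> n)) n"
      using that(1,2) by (simp add: sum.delta)
    finally show ?thesis by (simp add: lookup_sum)
  qed
  show "\<exists>!w. ?good w"
  proof (rule ex1I[of _ "\<lambda>c. fibre (component v c)"])
    let ?C = "{c. component v c \<noteq> 0}"
    have C: "{c. fibre (component v c) \<noteq> \<zero>\<^bsub>M\<^esub>} = ?C"
      by (simp add: zero_M fibre_inj)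
    have "?C \<subseteq> \<kappa> ` Poly_Mapping.keys v"
      by (auto simp: component_def weight_vec_simps in_keys_iff split: if_splits)
    then have fin: "finite ?C"
      by (rule finite_subset) simp
    have ws: "fibre (component v c) \<in> weight_space q m M c" for c
      by (simp add: weight_space_M component_def)
    have "(\<Sum>c\<in>?C. component v c) = v"
      using unique[OF fin, of "component v"] ws
      by (intro poly_mapping_eqI) (simp add: component_def)
    with fin ws show "?good (\<lambda>c. fibre (component v c))"
      by (simp add: C finsum_M x)
  next
    fix w assume w: "?good w"
    define u where "u c = inv_into UNIV fibre (w c)" for c
    have wu: "w c = fibre (u c)" for c
    proof -
      have "w c \<in> range fibre"
        using w by (auto simp: weight_space_def simp flip: carrier_M)
      then show ?thesis by (simp add: u_def f_inv_into_f)
    qed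
    let ?C = "{c. u c \<noteq> 0}"
    have C: "{c. w c \<noteq> \<zero>\<^bsub>M\<^esub>} = ?C"
      by (simp add: zero_M fibre_inj wu)
    have fin: "finite ?C" and ws: "fibre (u c) \<in> weight_space q m M c"
      and v: "v = (\<Sum>c\<in>?C. u c)" for c
      using w C by (auto simp: wu x finsum_M fibre_inj)
    have "poly_mapping.lookup v n = poly_mapping.lookup (u (\<kappa> n)) n" for n
      by (subst v) (rule unique[OF fin _ ws], simp)
    then have "u c = component v c" for c
      using ws[of c] by (auto simp: component_def weight_vec_simps weight_space_M)
    then show "w = (\<lambda>c. fibre (component v c))"
      by (simp add: wu fun_eq_iff)
  qed
qed

end


section \<open>Weights in closed form\<close>

definition K_weight :: "complex \<Rightarrow> complex \<Rightarrow> int \<Rightarrow> complex"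
  where "K_weight q \<beta> n = q powi (2 * n) * \<beta>"

text \<open>
  The solution of \<open>\<epsilon>(0) = \<alpha>\<close>, \<open>\<epsilon>(n + 1) = \<epsilon>(n) - f\<^sub>m(q\<^sup>2\<^sup>n \<beta>)\<close>, valid for \<open>n\<close> of either sign because the
  geometric sum \<open>(1 - x\<^sup>n) / (1 - x)\<close> satisfies its recursion for negative \<open>n\<close> too.
\<close>

definition xi_weight :: "complex \<Rightarrow> nat \<Rightarrow> complex \<Rightarrow> complex \<Rightarrow> int \<Rightarrow> complex"
  where "xi_weight q m \<alpha> \<beta> n = \<alpha> - 1 / (q - inverse q) *
      ((1 - q powi (2 * n * int m)) / (1 - q powi (2 * int m)) * \<beta> powi (int m)
       - (1 - q powi (-2 * n * int m)) / (1 - q powi (-2 * int m)) * \<beta> powi (- int m))"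

lemma powi_eq_one_iff:
  fixes q :: complex
  assumes q: "q \<noteq> 0" "\<And>k::nat. k \<ge> 1 \<Longrightarrow> q ^ k \<noteq> 1"
  shows "q powi n = 1 \<longleftrightarrow> n = 0"
proof
  assume "q powi n = 1"
  then have "q ^ nat \<bar>n\<bar> = 1"
    by (cases "0 \<le> n") (auto simp: power_int_def power_inverse)
  then show "n = 0"
    using q(2)[of "nat \<bar>n\<bar>"] by (cases "n = 0") auto
qed simp

lemma regular_weight_string_xi_weight:
  fixes q \<alpha> \<beta> :: complex and m :: nat
  assumes q: "q \<noteq> 0" "\<And>k::nat. k \<ge> 1 \<Longrightarrow> q ^ k \<noteq> 1" and m: "m \<ge> 1" and \<beta>: "\<beta> \<noteq> 0"
    and xi: "\<And>n. xi_weight q m \<alpha> \<beta> n \<noteq> 0"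
  shows "regular_weight_string q m (K_weight q \<beta>) (xi_weight q m \<alpha> \<beta>)"
proof
  note powi = powi_eq_one_iff[OF q]
  show "K_weight q \<beta> n \<noteq> 0" for n
    using q(1) \<beta> by (simp add: K_weight_def)
  show "K_weight q \<beta> (n + 1) = q\<^sup>2 * K_weight q \<beta> n" for n
    using q(1) by (simp add: K_weight_def power_int_add distrib_left)
  show "inj (K_weight q \<beta>)"
  proof (rule injI)
    fix i j assume "K_weight q \<beta> i = K_weight q \<beta> j"
    then have "q powi (2 * i - 2 * j) = 1"
      using q(1) \<beta> by (simp add: K_weight_def power_int_diff)
    then show "i = j"
      by (simp add: powi)
  qed
  show "xi_weight q m \<alpha> \<beta> (n + 1) = xi_weight q m \<alpha> \<beta> n -
      (K_weight q \<beta> n ^ m - inverse (K_weight q \<beta> n) ^ m) / (q - inverse q)" for n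
  proof -
    \<comment> \<open>One geometric sum serves both summands, with \<open>s = m\<close> and with \<open>s = - m\<close>.\<close>
    define G where "G s n = (1 - q powi (2 * n * s)) / (1 - q powi (2 * s))" for s n
    have xi_G: "xi_weight q m \<alpha> \<beta> n = \<alpha> - 1 / (q - inverse q) *
        (G (int m) n * \<beta> powi (int m) - G (- int m) n * \<beta> powi (- int m))" for n
      by (simp add: xi_weight_def G_def)
    have G_step: "G s (n + 1) = G s n + q powi (2 * n * s)" if "s \<noteq> 0" for s
    proof -
      have "1 - q powi (2 * s) \<noteq> 0"
        using powi[of "2 * s"] that by simp
      moreover have "q powi (2 * (n + 1) * s) = q powi (2 * n * s) * q powi (2 * s)"
        using q(1) by (simp add: algebra_simps flip: power_int_add)
      ultimately show ?thesis
        by (simp add: G_def field_simps)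
    qed
    have "K_weight q \<beta> n ^ m = q powi (2 * n * int m) * \<beta> powi int m"
      by (simp add: K_weight_def power_mult_distrib power_int_mult)
    moreover have "inverse (K_weight q \<beta> n) ^ m = q powi (- 2 * n * int m) * \<beta> powi (- int m)"
      by (simp add: K_weight_def power_mult_distrib power_int_mult power_int_minus flip: power_inverse)
    ultimately show ?thesis
      using G_step[of "int m"] G_step[of "- int m"] m
      by (simp add: xi_G algebra_simps add_divide_distrib diff_divide_distrib)
  qed
qed (rule xi)

text \<open>
  At nonpositive indices the closed form becomes, by \<open>1 / (1 - x) = - x\<^sup>-\<^sup>1 / (1 - x\<^sup>-\<^sup>1)\<close>, the expression
  in the first family of excluded values of \<open>\<alpha>\<close>.
\<close>

lemma xi_weight_uminus:
  fixes q :: complex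
  assumes q: "q \<noteq> 0" "\<And>k::nat. k \<ge> 1 \<Longrightarrow> q ^ k \<noteq> 1" and m: "m \<ge> 1"
  shows "xi_weight q m \<alpha> \<beta> (- n) = \<alpha> + 1 / (q - inverse q) *
      (q powi (-2 * int m) * (1 - q powi (-2 * n * int m)) / (1 - q powi (-2 * int m))
          * \<beta> powi (int m)
       - q powi (2 * int m) * (1 - q powi (2 * n * int m)) / (1 - q powi (2 * int m))
          * \<beta> powi (- int m))"
proof -
  have reflect: "x / (1 - q powi s) = - (q powi (- s) * x / (1 - q powi (- s)))" if "s \<noteq> 0" for s x
  proof -
    have "q powi s \<noteq> 0" "1 - q powi s \<noteq> 0" "1 - q powi (- s) \<noteq> 0"
      using powi_eq_one_iff[OF q, of s] powi_eq_one_iff[OF q, of "- s"] q(1) that by auto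
    then show ?thesis
      by (simp add: power_int_minus field_simps)
  qed
  have "(1 - q powi (2 * - n * int m)) / (1 - q powi (2 * int m))
      = - (q powi (-2 * int m) * (1 - q powi (-2 * n * int m)) / (1 - q powi (-2 * int m)))"
    using reflect[of "2 * int m"] m by simp
  moreover have "(1 - q powi (-2 * - n * int m)) / (1 - q powi (-2 * int m))
      = - (q powi (2 * int m) * (1 - q powi (2 * n * int m)) / (1 - q powi (2 * int m)))"
    using reflect[of "-2 * int m"] m by simp
  ultimately show ?thesis
    unfolding xi_weight_def by (simp only:) (simp add: right_diff_distrib)
qed

theorem theorem2p4:
  fixes q \<alpha> \<beta> :: complex and m :: nat
  assumes "q \<noteq> 0"
    and "\<forall>k::nat. k \<ge> 1 \<longrightarrow> q ^ k \<noteq> 1"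
    and "m \<ge> 1"
    and "\<beta> \<noteq> 0"
    and "\<forall>n::nat. \<alpha> \<noteq> - (1 / (q - inverse q)) *
      (q powi (-2 * int m) * (1 - q powi (-2 * int n * int m)) / (1 - q powi (-2 * int m))
          * \<beta> powi (int m)
       - q powi (2 * int m) * (1 - q powi (2 * int n * int m)) / (1 - q powi (2 * int m))
          * \<beta> powi (- int m))"
    and "\<forall>n::nat. n \<ge> 1 \<longrightarrow> \<alpha> \<noteq> 1 / (q - inverse q) *
      ((1 - q powi (2 * int n * int m)) / (1 - q powi (2 * int m)) * \<beta> powi (int m)
       - (1 - q powi (-2 * int n * int m)) / (1 - q powi (-2 * int m)) * \<beta> powi (- int m))"
  shows "weight_representation q m (U_mod q m (M_ideal q m \<alpha> \<beta>)) \<and>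
    irreducible_module (U_alg q m) (U_mod q m (M_ideal q m \<alpha> \<beta>)) \<and>
    \<not> finite_dimensional q m (U_mod q m (M_ideal q m \<alpha> \<beta>))"
proof -
  note q = assms(1) assms(2)[rule_format]
  have "xi_weight q m \<alpha> \<beta> n \<noteq> 0" for n
  proof (cases "1 \<le> n")
    case True
    then have "nat n \<ge> 1" "int (nat n) = n" by simp_all
    then show ?thesis
      using assms(6)[rule_format, of "nat n"] by (simp add: xi_weight_def)
  next
    case False
    then have "n = - int (nat (- n))" by simp
    then show ?thesis
      using assms(5)[rule_format, of "nat (- n)"] xi_weight_uminus[OF q assms(3), of \<alpha> \<beta> "int (nat (- n))"]
      by (metis add_eq_0_iff2 mult_minus_left)
  qed
  then interpret regular_weight_string q m "K_weight q \<beta>" "xi_weight q m \<alpha> \<beta>"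
    by (intro regular_weight_string_xi_weight q assms(3,4))
  have "K_weight q \<beta> 0 = \<beta>" "xi_weight q m \<alpha> \<beta> 0 = \<alpha>"
    by (simp_all add: K_weight_def xi_weight_def)
  then show ?thesis
    using weight_representation_M irreducible_M not_finite_dimensional_M by simp
qed

end
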